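(* For every odd prime $p$, there exists a group $G$ of order $p^9$ such that $\mathrm{Aut}(G)$ is elementary abelian of order $p^{20}$, $\Phi(G) < Z(G)$, and $\gamma_2(G) = \Phi(G)$ is elementary abelian.
   Context: For a finite group $G$, $\gamma_2(G)$, $Z(G)$ and $\Phi(G)$ denote the commutator subgroup, the center and the Frattini subgroup of $G$, respectively, and $\mathrm{Aut}(G)$ denotes the group of all automorphisms of $G$. The notation $H < K$ means that $H$ is a proper subgroup of $K$. *)

theory Defs
  imports "HOL-Algebra.Generated_Groups" "HOL-Algebra.Bij" "HOL-Computational_Algebra.Primes"
begin

definition center :: "('a, 'b) monoid_scheme \<Rightarrow> 'a set" where
  "center G = {z \<in> carrier G. \<forall>x \<in> carrier G. z \<otimes>\<^bsub>G\<^esub> x = x \<otimes>\<^bsub>G\<^esub> z}"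

definition maximal_subgroup :: "'a set \<Rightarrow> ('a, 'b) monoid_scheme \<Rightarrow> bool" where
  "maximal_subgroup M G \<longleftrightarrow> subgroup M G \<and> M \<noteq> carrier G \<and>
     (\<forall>H. subgroup H G \<and> M \<subseteq> H \<longrightarrow> H = M \<or> H = carrier G)"

text \<open>Intersecting with the carrier yields the usual convention that the Frattini subgroup
  is the whole group when there are no maximal subgroups.\<close>

definition frattini :: "('a, 'b) monoid_scheme \<Rightarrow> 'a set" where
  "frattini G = carrier G \<inter> \<Inter>{M. maximal_subgroup M G}"

text \<open>For prime \<open>p\<close>; the trivial group is included. Finiteness is not part of the definition.\<close>

definition elementary_abelian :: "nat \<Rightarrow> ('a, 'b) monoid_scheme \<Rightarrow> bool" where
  "elementary_abelian p G \<longleftrightarrow> comm_group G \<and> (\<forall>x \<in> carrier G. x [^]\<^bsub>G\<^esub> p = \<one>\<^bsub>G\<^esub>)"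

text \<open>The centre and the Frattini subgroup are subgroups, so that \<open>frattini G \<subset> center G\<close> says
  that the former is a proper subgroup of the latter.\<close>

lemma (in group) subgroup_center: "subgroup (center G) G"
proof (rule subgroupI)
  show "center G \<subseteq> carrier G" by (auto simp: center_def)
  have "\<one> \<in> center G" by (simp add: center_def)
  then show "center G \<noteq> {}" by blast
next
  fix a assume a: "a \<in> center G"
  then have ac: "a \<in> carrier G" by (simp add: center_def)
  have "inv a \<otimes> x = x \<otimes> inv a" if x: "x \<in> carrier G" for x
  proof -
    have "a \<otimes> x = x \<otimes> a" using a x by (simp add: center_def)
    then have "a \<otimes> (x \<otimes> inv a) = x"
      using ac x by (simp add: m_assoc [symmetric]) (simp add: m_assoc)
    then have "inv a \<otimes> x = inv a \<otimes> (a \<otimes> (x \<otimes> inv a))" by simp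
    also have "\<dots> = x \<otimes> inv a" using ac x by (simp add: m_assoc [symmetric])
    finally show ?thesis .
  qed
  then show "inv a \<in> center G" using ac by (simp add: center_def)
next
  fix a b assume "a \<in> center G" "b \<in> center G"
  then have c: "a \<in> carrier G" "b \<in> carrier G"
    and comm: "\<And>x. x \<in> carrier G \<Longrightarrow> a \<otimes> x = x \<otimes> a" "\<And>x. x \<in> carrier G \<Longrightarrow> b \<otimes> x = x \<otimes> b"
    by (auto simp: center_def)
  have "a \<otimes> b \<otimes> x = x \<otimes> (a \<otimes> b)" if x: "x \<in> carrier G" for x
  proof -
    have "a \<otimes> b \<otimes> x = a \<otimes> (x \<otimes> b)" using c x comm(2)[OF x] by (simp add: m_assoc)
    also have "\<dots> = (x \<otimes> a) \<otimes> b" using c x comm(1)[OF x] by (simp add: m_assoc [symmetric])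
    finally show ?thesis using c x by (simp add: m_assoc)
  qed
  then show "a \<otimes> b \<in> center G" using c by (simp add: center_def)
qed

lemma (in group) subgroup_frattini: "subgroup (frattini G) G"
proof -
  have "frattini G = \<Inter>(insert (carrier G) {M. maximal_subgroup M G})"
    by (auto simp: frattini_def)
  moreover have "subgroup (\<Inter>(insert (carrier G) {M. maximal_subgroup M G})) G"
    by (rule subgroups_Inter) (auto simp: maximal_subgroup_def subgroup_self)
  ultimately show ?thesis by simp
qed

end

(* The group has generators x0, ..., x4 with x4 of order p and the others of order p^2, with
   x3 central, p-th powers central and
     [x2,x4] = x1^p, [x1,x4] = x0^p, [x0,x4] = x3^p, [x0,x2] = [x1,x2] = x2^p, [x0,x1] = 1.
   An automorphism acts on G/Phi(G) by a matrix over the field with p elements.  It sends x4 to a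
   power x4^l modulo Phi(G), because that line is the kernel of the p-power map.  The chain
   x2 -> x1 -> x0 -> x3 given by commutation with x4 then expresses the images of x1, x0, x3 through
   l and the image of x2, and the remaining relations force the matrix to be the identity.
   Since p-th powers are central and commutators depend only on classes modulo Phi(G), every choice
   of five elements c_k of Phi(G) conversely gives an automorphism x_k -> x_k c_k, and these
   multiply like the tuples (c_k); so Aut(G) is Phi(G)^5, of order (p^4)^5. *)
theory Submission
  imports Defs "HOL-Number_Theory.Cong"
begin

section \<open>Maximal subgroups, the center and the Frattini subgroup in a general group\<close>

lemma (in group) subgroup_mult_center:
  assumes "subgroup M G"
  shows "subgroup (M <#> center G) G"
proof (rule subgroupI)
  have M: "M \<subseteq> carrier G" "\<one> \<in> M" using assms by (auto simp: subgroup.subset subgroup.one_closed)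
  have Z: "center G \<subseteq> carrier G" "\<one> \<in> center G"
    using subgroup_center by (auto simp: subgroup.subset subgroup.one_closed)
  have comm: "z \<otimes> x = x \<otimes> z" if "z \<in> center G" "x \<in> carrier G" for x z
    using that by (auto simp: center_def)
  show "M <#> center G \<subseteq> carrier G" using M Z by (auto simp: set_mult_def)
  show "M <#> center G \<noteq> {}" using M Z by (auto simp: set_mult_def)
  fix a assume "a \<in> M <#> center G"
  then obtain m z where a: "a = m \<otimes> z" "m \<in> M" "z \<in> center G" by (auto simp: set_mult_def)
  then have c: "m \<in> carrier G" "z \<in> carrier G" using M Z by auto
  have i: "inv m \<in> M" "inv z \<in> center G"
    using a assms subgroup_center by (auto simp: subgroup.m_inv_closed)
  have "inv a = inv m \<otimes> inv z" using a c comm[OF i(2), of "inv m"] by (simp add: inv_mult_group)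
  then show "inv a \<in> M <#> center G" using i by (auto simp: set_mult_def)
  fix b assume "b \<in> M <#> center G"
  then obtain n y where b: "b = n \<otimes> y" "n \<in> M" "y \<in> center G" by (auto simp: set_mult_def)
  then have d: "n \<in> carrier G" "y \<in> carrier G" using M Z by auto
  have "a \<otimes> b = m \<otimes> (z \<otimes> n) \<otimes> y" using a b c d by (simp add: m_assoc)
  also have "\<dots> = (m \<otimes> n) \<otimes> (z \<otimes> y)" using a c d comm[of z n] by (simp add: m_assoc)
  finally show "a \<otimes> b \<in> M <#> center G"
    using a b assms subgroup_center unfolding set_mult_def
    by (blast intro: subgroup.m_closed)
qed

text \<open>Central factors cancel, so \<open>M <#> center G\<close> has no commutators beyond those
  of \<open>M\<close>.\<close>

lemma (in group) commutator_mult_center: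
  assumes "m \<in> carrier G" "n \<in> carrier G" "z \<in> center G" "y \<in> center G"
  shows "(m \<otimes> z) \<otimes> (n \<otimes> y) \<otimes> inv (m \<otimes> z) \<otimes> inv (n \<otimes> y) = m \<otimes> n \<otimes> inv m \<otimes> inv n"
proof -
  have c: "z \<in> carrier G" "y \<in> carrier G" using assms by (auto simp: center_def)
  have comm: "z \<otimes> x = x \<otimes> z" "y \<otimes> x = x \<otimes> y" if "x \<in> carrier G" for x
    using assms that by (auto simp: center_def)
  have cancel: "a \<otimes> u \<otimes> inv (b \<otimes> u) = a \<otimes> inv b"
    if "a \<in> carrier G" "b \<in> carrier G" "u \<in> carrier G" for a b u
  proof -
    have "u \<otimes> (inv u \<otimes> inv b) = inv b" using that by (simp flip: m_assoc)
    then show ?thesis using that by (simp add: inv_mult_group m_assoc)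
  qed
  have "(m \<otimes> z) \<otimes> (n \<otimes> y) = (m \<otimes> n) \<otimes> (z \<otimes> y)"
    using assms c comm(1)[of n] by (metis m_assoc m_closed)
  moreover have "inv (m \<otimes> z) \<otimes> inv (n \<otimes> y) = inv ((n \<otimes> y) \<otimes> (m \<otimes> z))"
    using assms c by (simp add: inv_mult_group)
  moreover have "(n \<otimes> y) \<otimes> (m \<otimes> z) = (n \<otimes> m) \<otimes> (z \<otimes> y)"
    using assms c comm(2) by (metis m_assoc m_closed)
  moreover have "(m \<otimes> n) \<otimes> (z \<otimes> y) \<otimes> inv ((n \<otimes> m) \<otimes> (z \<otimes> y)) = m \<otimes> n \<otimes> inv (n \<otimes> m)"
    using cancel assms c by simp
  ultimately show ?thesis using assms c by (simp add: m_assoc inv_mult_group)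
qed

text \<open>If a maximal \<open>M\<close> misses a central element, then
  \<open>M <#> center G\<close> is the whole group. Every commutator is then one of elements of
  \<open>M\<close>, so the derived subgroup lies in \<open>M\<close>.\<close>

lemma (in group) derived_Int_center_subset_frattini:
  "derived G (carrier G) \<inter> center G \<subseteq> frattini G"
proof
  fix x assume x: "x \<in> derived G (carrier G) \<inter> center G"
  then have xc: "x \<in> carrier G" by (auto simp: center_def)
  have "x \<in> M" if M: "maximal_subgroup M G" for M
  proof (rule ccontr)
    assume nx: "x \<notin> M"
    have sub: "subgroup M G" using M by (simp add: maximal_subgroup_def)
    have Mc: "M \<subseteq> carrier G" "\<one> \<in> M" using sub by (auto simp: subgroup.subset subgroup.one_closed)
    have "\<one> \<in> center G" using subgroup_center by (simp add: subgroup.one_closed)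
    then have "M \<subseteq> M <#> center G" using Mc by (force simp: set_mult_def)
    moreover have "x \<in> M <#> center G" using x Mc xc by (force simp: set_mult_def)
    ultimately have eq: "M <#> center G = carrier G"
      using M nx subgroup_mult_center[OF sub] unfolding maximal_subgroup_def by blast
    have "g \<otimes> h \<otimes> inv g \<otimes> inv h \<in> M" if gh: "g \<in> carrier G" "h \<in> carrier G" for g h
    proof -
      obtain m z where g: "g = m \<otimes> z" "m \<in> M" "z \<in> center G"
        using gh eq by (force simp: set_mult_def)
      obtain n y where h: "h = n \<otimes> y" "n \<in> M" "y \<in> center G"
        using gh eq by (force simp: set_mult_def)
      have "g \<otimes> h \<otimes> inv g \<otimes> inv h = m \<otimes> n \<otimes> inv m \<otimes> inv n"
        using g h Mc commutator_mult_center by blast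
      then show ?thesis using g h sub by (simp add: subgroup.m_closed subgroup.m_inv_closed)
    qed
    then have "derived G (carrier G) \<subseteq> M"
      unfolding derived_def using sub by (intro generate_subgroup_incl) auto
    then show False using x nx by auto
  qed
  then show "x \<in> frattini G" using xc by (auto simp: frattini_def)
qed

text \<open>Here \<open>\<phi>\<close> is a homomorphism onto the integers modulo \<open>p\<close>,
  given by integer representatives and hence additive only up to congruence. Its kernel has prime
  index.\<close>

lemma (in group) maximal_subgroup_hom_mod_prime:
  fixes p :: int and \<phi> :: "'a \<Rightarrow> int"
  assumes p: "prime p"
    and hom: "\<And>x y. x \<in> carrier G \<Longrightarrow> y \<in> carrier G \<Longrightarrow> [\<phi> (x \<otimes> y) = \<phi> x + \<phi> y] (mod p)"
    and ex: "u \<in> carrier G" "\<not> p dvd \<phi> u"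
  shows "maximal_subgroup {x \<in> carrier G. p dvd \<phi> x} G" (is "maximal_subgroup ?M G")
proof -
  have dvd: "p dvd \<phi> (x \<otimes> y) \<longleftrightarrow> p dvd \<phi> x + \<phi> y" if "x \<in> carrier G" "y \<in> carrier G" for x y
    using hom[OF that] by (rule cong_dvd_iff)
  have one: "p dvd \<phi> \<one>" using hom[of \<one> \<one>] by (simp add: cong_iff_dvd_diff)
  have inv: "p dvd \<phi> (inv x) + \<phi> x" if "x \<in> carrier G" for x
    using dvd[of "inv x" x] that one by simp
  have sub: "subgroup ?M G"
  proof (rule subgroupI)
    show "?M \<noteq> {}" using one by auto
    show "inv x \<in> ?M" if "x \<in> ?M" for x
      using that inv[of x] by (auto simp: dvd_add_left_iff)
  qed (auto simp: dvd)
  have pow: "[\<phi> (x [^] n) = int n * \<phi> x] (mod p)" if x: "x \<in> carrier G" for x and n :: nat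
  proof (induction n)
    case 0 then show ?case using one by (simp add: cong_0_iff)
  next
    case (Suc n)
    have "[\<phi> (x [^] Suc n) = \<phi> (x [^] n) + \<phi> x] (mod p)" using hom x by simp
    also have "[\<phi> (x [^] n) + \<phi> x = int n * \<phi> x + \<phi> x] (mod p)"
      using Suc by (intro cong_add cong_refl)
    finally show ?case by (simp add: algebra_simps)
  qed
  have "H = carrier G" if H: "subgroup H G" "?M \<subseteq> H" "H \<noteq> ?M" for H
  proof -
    obtain h where h: "h \<in> H" "h \<in> carrier G" "\<not> p dvd \<phi> h"
      using H subgroup.subset[OF H(1)] by blast
    have "coprime (\<phi> h) p" using p h(3) by (metis coprime_commute prime_imp_coprime)
    then obtain k where k: "[\<phi> h * k = 1] (mod p)" using cong_solve_coprime_int by blast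
    have "g \<in> H" if g: "g \<in> carrier G" for g
    proof -
      \<comment> \<open>Since \<open>k\<close> inverts \<open>\<phi> h\<close> modulo
        \<open>p\<close>, multiplying \<open>g\<close> by this power of \<open>h\<close> moves it
        into the kernel. The residue makes the exponent a natural number.\<close>
      define n where "n = nat ((k * - \<phi> g) mod p)"
      have n: "[int n = k * - \<phi> g] (mod p)" using p by (simp add: n_def cong_def prime_gt_0_int)
      have "[\<phi> g + \<phi> (h [^] n) = \<phi> g + (k * - \<phi> g) * \<phi> h] (mod p)"
        using pow[OF h(2), of n] cong_scalar_right[OF n, of "\<phi> h"]
        by (meson cong_add_lcancel cong_trans)
      also have "\<phi> g + (k * - \<phi> g) * \<phi> h = \<phi> g * (1 - \<phi> h * k)" by (simp add: algebra_simps)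
      also have "[\<dots> = 0] (mod p)" 
        using cong_sym[OF k] by (simp add: cong_0_iff cong_iff_dvd_diff)
      finally have "g \<otimes> h [^] n \<in> ?M" using g h dvd by (simp add: cong_0_iff)
      then have "g \<otimes> h [^] n \<in> H" using H by blast
      moreover have "h [^] n \<in> H"
        using H(1) h(1) by (induction n) (auto simp: subgroup.one_closed subgroup.m_closed)
      then have "inv (h [^] n) \<in> H" using H(1) by (simp add: subgroup.m_inv_closed)
      ultimately have "(g \<otimes> h [^] n) \<otimes> inv (h [^] n) \<in> H"
        using H(1) by (simp add: subgroup.m_closed)
      then show ?thesis using g h by (simp add: m_assoc)
    qed
    then show ?thesis using subgroup.subset[OF H(1)] by blast
  qed
  then show ?thesis using sub ex unfolding maximal_subgroup_def by blast
qed

section \<open>The cocycle and matrices acting on exponent vectors\<close>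

text \<open>The component \<open>i = 4\<close> of the cocycle is junk: that coordinate is read modulo \<open>p\<close>, whereas
  the cocycle enters the product multiplied by \<open>p\<close>.\<close>

definition bform :: "nat \<Rightarrow> (nat \<Rightarrow> int) \<Rightarrow> (nat \<Rightarrow> int) \<Rightarrow> int" where
  "bform i v w = (if i = 0 then v 1 * w 4 else if i = 1 then v 2 * w 4
     else if i = 2 then (v 0 + v 1) * w 2 else v 0 * w 4)"

text \<open>Up to the factor p this is the exponent vector of a commutator; see
  \<open>mk_commutator\<close>.\<close>

definition comm_form :: "nat \<Rightarrow> (nat \<Rightarrow> int) \<Rightarrow> (nat \<Rightarrow> int) \<Rightarrow> int" where
  "comm_form i v w = bform i v w - bform i w v"

definition unit_vec :: "nat \<Rightarrow> nat \<Rightarrow> int" where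
  "unit_vec k = (\<lambda>i. if i = k then 1 else 0)"

lemma bform_add_left: "bform i (\<lambda>j. v j + w j) u = bform i v u + bform i w u"
  by (simp add: bform_def algebra_simps)

lemma bform_add_right: "bform i u (\<lambda>j. v j + w j) = bform i u v + bform i u w"
  by (simp add: bform_def algebra_simps)

lemma bform_scale_left: "bform i (\<lambda>j. c * v j) w = c * bform i v w"
  by (simp add: bform_def algebra_simps)

lemma bform_scale_right: "bform i v (\<lambda>j. c * w j) = c * bform i v w"
  by (simp add: bform_def algebra_simps)

lemma bform_diff_left: "bform i (\<lambda>j. v j - w j) u = bform i v u - bform i w u"
  by (simp add: bform_def algebra_simps)

lemma bform_scale_left': "bform i (\<lambda>j. v j * c) w = bform i v w * c"
  by (simp add: bform_def algebra_simps)

lemma bform_zero: "bform i (\<lambda>j. 0) w = 0" "bform i w (\<lambda>j. 0) = 0"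
  by (simp_all add: bform_def)

lemmas bform_linear = bform_add_left bform_add_right bform_scale_left bform_scale_left'
  bform_scale_right bform_diff_left bform_zero

lemma bform_cong:
  assumes "\<And>i. i < 5 \<Longrightarrow> [v i = v' i] (mod m)" "\<And>i. i < 5 \<Longrightarrow> [w i = w' i] (mod m)"
  shows "[bform i v w = bform i v' w'] (mod m)"
  unfolding bform_def using assms by (auto intro!: cong_mult cong_add)

text \<open>Row vector times matrix. Indexing by pairs makes the matrices a function space on a
  product set, which can be counted.\<close>

definition lin :: "(nat \<times> nat \<Rightarrow> int) \<Rightarrow> (nat \<Rightarrow> int) \<Rightarrow> nat \<Rightarrow> int" where
  "lin C v i = (\<Sum>k<5. v k * C (k, i))"

lemma lin_add: "lin C (\<lambda>i. v i + w i) i = lin C v i + lin C w i"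
  by (simp add: lin_def sum.distrib distrib_right)

lemma lin_scale: "lin C (\<lambda>i. c * v i) i = c * lin C v i"
  by (simp add: lin_def sum_distrib_left mult.assoc)

lemma lin_add_matrix: "lin (\<lambda>x. C x + D x) v i = lin C v i + lin D v i"
  by (simp add: lin_def sum.distrib distrib_left)

lemma lin_zero_matrix: "lin (\<lambda>x. 0) v i = 0"
  by (simp add: lin_def)

lemma lin_unit_vec: "k < 5 \<Longrightarrow> lin C (unit_vec k) i = C (k, i)"
  by (simp add: lin_def unit_vec_def if_distrib[of "\<lambda>x. x * _"] sum.delta cong: if_cong)

lemma lin_cong:
  assumes "\<And>k. k < 5 \<Longrightarrow> [v k = w k] (mod m)" "\<And>k. k < 5 \<Longrightarrow> [C (k, i) = D (k, i)] (mod m)"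
  shows "[lin C v i = lin D w i] (mod m)"
  unfolding lin_def using assms by (intro cong_sum cong_mult) auto

section \<open>Rigidity of the relations modulo p\<close>

text \<open>Here \<open>akj\<close> is the exponent of \<open>x\<^sub>j\<close> in the image of \<open>x\<^sub>k\<close> for \<open>k < 4\<close>, the image of \<open>x\<^sub>4\<close> has
  exponents \<open>z0, \<dots>, z3, l\<close>, and \<open>rkj\<close> expresses the relation for \<open>[x\<^sub>k, x\<^sub>j]\<close>.\<close>

lemma rigid_relations_mod_prime:
  fixes p :: int
  assumes p: "prime p"
    and z: "p dvd z0" "p dvd z1" "p dvd z2" "p dvd z3"
    and r24: "p dvd a21 * l - z1 * a24 - a10" "p dvd a22 * l - z2 * a24 - a11"
      "p dvd (a20 + a21) * z2 - (z0 + z1) * a22 - a12" "p dvd a20 * l - z0 * a24 - a13"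
    and r14: "p dvd a11 * l - z1 * a14 - a00" "p dvd a12 * l - z2 * a14 - a01"
      "p dvd (a10 + a11) * z2 - (z0 + z1) * a12 - a02" "p dvd a10 * l - z0 * a14 - a03"
    and r04: "p dvd a01 * l - z1 * a04 - a30" "p dvd a02 * l - z2 * a04 - a31"
      "p dvd (a00 + a01) * z2 - (z0 + z1) * a02 - a32" "p dvd a00 * l - z0 * a04 - a33"
    and r02: "p dvd a01 * a24 - a21 * a04 - a20" "p dvd a02 * a24 - a22 * a04 - a21"
      "p dvd (a00 + a01) * a22 - (a20 + a21) * a02 - a22" "p dvd a00 * a24 - a20 * a04 - a23"
    and r12: "p dvd a11 * a24 - a21 * a14 - a20"
      "p dvd (a10 + a11) * a22 - (a20 + a21) * a12 - a22"
    and r01: "p dvd a01 * a14 - a11 * a04" "p dvd a00 * a14 - a10 * a04"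
    and r03: "p dvd a00 * a34 - a30 * a04"
    and nz: "\<not> (p dvd a30 \<and> p dvd a31 \<and> p dvd a32 \<and> p dvd a33)"
  shows "p dvd a00 - 1 \<and> p dvd a01 \<and> p dvd a02 \<and> p dvd a03 \<and> p dvd a04"
    and "p dvd a10 \<and> p dvd a11 - 1 \<and> p dvd a12 \<and> p dvd a13 \<and> p dvd a14"
    and "p dvd a20 \<and> p dvd a21 \<and> p dvd a22 - 1 \<and> p dvd a23 \<and> p dvd a24"
    and "p dvd a30 \<and> p dvd a31 \<and> p dvd a32 \<and> p dvd a33 - 1 \<and> p dvd a34"
    and "p dvd l - 1"
proof -
  \<comment> \<open>With the entries \<open>z0\<close> to \<open>z3\<close> zero modulo
    \<open>p\<close>, commuting with the image of x4 multiplies by \<open>l\<close> and shifts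
    coordinates. This expresses rows 1, 0 and 3 successively through row 2.\<close>
  have a1: "p dvd a10 - l * a21" "p dvd a11 - l * a22" "p dvd a12" "p dvd a13 - l * a20"
    using z r24 by algebra+
  have a0: "p dvd a00 - l * l * a22" "p dvd a01" "p dvd a02" "p dvd a03 - l * l * a21"
    using z a1 r14 by algebra+
  have a3: "p dvd a30" "p dvd a31" "p dvd a32" "p dvd a33 - l * l * l * a22"
    using z a0 r04 by algebra+
  \<comment> \<open>If \<open>l\<close> or \<open>a22\<close> vanished modulo \<open>p\<close>, so
    would the whole row of x3.\<close>
  have "\<not> p dvd a33" using a3 nz by blast
  moreover have "p dvd a33" if "p dvd l" using a3(4) that by algebra
  moreover have "p dvd a33" if "p dvd a22" using a3(4) that by algebra
  ultimately have "\<not> p dvd l" "\<not> p dvd a22" by blast+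
  then have cancel: "p dvd x" if "p dvd l * x \<or> p dvd a22 * x" for x
    using that p prime_dvd_multD by blast
  \<comment> \<open>Since [x0,x1] = 1, the exponents of x4 in the images of x0 and x1
    vanish.\<close>
  have "p dvd l * (a22 * a04)" using r01(1) a0(2) a1(2) by algebra
  then have a04: "p dvd a04" using cancel by blast
  have "p dvd l * (l * (a22 * a14))" using r01(2) a0(1) a04 by algebra
  then have a14: "p dvd a14" using cancel by blast
  have a20: "p dvd a20" using r02(1) a0(2) a04 by algebra
  have a21: "p dvd a21" using r02(2) a0(3) a04 by algebra
  \<comment> \<open>The relation [x0,x2] = x2^p gives l^2 a22 = 1, and [x1,x2] = x2^p gives l a22 =
    1 below; together they force l = 1.\<close>
  have "p dvd a22 * (l * l * a22 - 1)" using r02(3) a0 by algebra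
  then have lla: "p dvd l * l * a22 - 1" using cancel by blast
  have "p dvd l * (a22 * a24)" using r12(1) a1(2) a14 a20 by algebra
  then have a24: "p dvd a24" using cancel by blast
  have a23: "p dvd a23" using r02(4) a24 a04 by algebra
  have "p dvd a22 * (l * a22 - 1)" using r12(2) a1 a20 a21 by algebra
  then have la: "p dvd l * a22 - 1" using cancel by blast
  show l: "p dvd l - 1" using la lla by algebra
  then have a22: "p dvd a22 - 1" using la by algebra
  show "p dvd a20 \<and> p dvd a21 \<and> p dvd a22 - 1 \<and> p dvd a23 \<and> p dvd a24"
    using a20 a21 a22 a23 a24 by blast
  have "p dvd a10" "p dvd a11 - 1" "p dvd a13" using a1 a20 a21 la by algebra+
  then show "p dvd a10 \<and> p dvd a11 - 1 \<and> p dvd a12 \<and> p dvd a13 \<and> p dvd a14"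
    using a1 a14 by blast
  have a00: "p dvd a00 - 1" "p dvd a03" using a0 a21 lla by algebra+
  then show "p dvd a00 - 1 \<and> p dvd a01 \<and> p dvd a02 \<and> p dvd a03 \<and> p dvd a04"
    using a0 a04 by blast
  have "p dvd a33 - 1" using a3(4) l lla by algebra
  moreover have "p dvd a34" using r03 a00 a04 by algebra
  ultimately show "p dvd a30 \<and> p dvd a31 \<and> p dvd a32 \<and> p dvd a33 - 1 \<and> p dvd a34"
    using a3 by blast
qed

section \<open>The group: coordinate vectors and their multiplication\<close>

locale odd_prime =
  fixes p :: nat
  assumes prime: "prime p" and odd: "odd p"
begin

text \<open>The order of the generator x_i.\<close>

definition q :: "nat \<Rightarrow> int" where
  "q i = (if i = 4 then int p else int p ^ 2)"

definition reduced :: "(nat \<Rightarrow> int) set" where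
  "reduced = (\<Pi>\<^sub>E i\<in>{..<5}. {0..<q i})"

text \<open>The carrier is to consist of natural numbers, so the reduced vectors are numbered by a
  bijection; nothing depends on which one.\<close>

definition enc :: "(nat \<Rightarrow> int) \<Rightarrow> nat" where
  "enc = (SOME f. bij_betw f reduced {..<p ^ 9})"

text \<open>Stands for the product of the powers x_k^(v k) in descending order of k. Unreduced
  vectors are accepted, so calculations use integer expressions and congruences.\<close>

definition mk :: "(nat \<Rightarrow> int) \<Rightarrow> nat" where
  "mk v = enc (\<lambda>i\<in>{..<5}. v i mod q i)"

definition coords :: "nat \<Rightarrow> nat \<Rightarrow> int" where
  "coords = inv_into reduced enc"

text \<open>Collecting a product into descending order moves x_k past x_j for k < j, at the cost of
  [x_k,x_j], which is trivial or a p-th power. The correction depends only on \<open>v\<close> and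
  \<open>w\<close> modulo p, because every \<open>q i\<close> divides p^2.\<close>

definition vec_mult :: "(nat \<Rightarrow> int) \<Rightarrow> (nat \<Rightarrow> int) \<Rightarrow> nat \<Rightarrow> int" where
  "vec_mult v w = (\<lambda>i. v i + w i + int p * bform i v w)"

definition G :: "nat monoid" where
  "G = \<lparr>carrier = {..<p ^ 9},
    monoid.mult = \<lambda>g h. mk (vec_mult (coords g) (coords h)),
    one = mk (\<lambda>i. 0)\<rparr>"

lemma p_pos: "0 < p" using prime by (rule prime_gt_0_nat)

lemma prime_int: "prime (int p)" using prime by simp

lemma q_pos: "0 < q i" using p_pos by (simp add: q_def)

lemma p_dvd_q: "int p dvd q i" by (simp add: q_def)

lemma cong_q_imp_cong_p: "[x = y] (mod q i) \<Longrightarrow> [x = y] (mod int p)"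
  using p_dvd_q cong_dvd_modulus by blast

lemma cong_q_p_mult:
  assumes "[x = y] (mod int p)"
  shows "[int p * x = int p * y] (mod q i)"
proof -
  have "int p * int p dvd int p * x - int p * y"
    using assms by (simp add: cong_iff_dvd_diff flip: right_diff_distrib)
  moreover have "q i dvd int p * int p" by (simp add: q_def power2_eq_square)
  ultimately show ?thesis unfolding cong_iff_dvd_diff using dvd_trans by blast
qed

lemma cong_q_p_mult_iff:
  assumes "i < 4"
  shows "[int p * x = int p * y] (mod q i) \<longleftrightarrow> [x = y] (mod int p)"
  using assms p_pos by (simp add: q_def power2_eq_square cong_iff_dvd_diff flip: right_diff_distrib)

lemma card_reduced: "card reduced = p ^ 9"
proof -
  have "card reduced = (\<Prod>i<5. nat (q i))" by (simp add: reduced_def card_PiE)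
  also have "{..<5} = {0, 1, 2, 3, 4 :: nat}" by auto
  also have "(\<Prod>i\<in>{0, 1, 2, 3, 4 :: nat}. nat (q i)) = p ^ 2 * (p ^ 2 * (p ^ 2 * (p ^ 2 * p)))"
    by (simp add: q_def nat_power_eq)
  also have "\<dots> = p ^ 9" by (simp add: power_numeral_reduce)
  finally show ?thesis .
qed

lemma bij_enc: "bij_betw enc reduced {..<p ^ 9}"
proof -
  have "finite reduced" using card_reduced p_pos card_gt_0_iff[of reduced] by simp
  then have "\<exists>f. bij_betw f reduced {..<p ^ 9}" by (intro finite_same_card_bij) (auto simp: card_reduced)
  then show ?thesis unfolding enc_def by (rule someI_ex)
qed

lemma mod_in_reduced: "(\<lambda>i\<in>{..<5}. v i mod q i) \<in> reduced"
  using q_pos by (auto simp: reduced_def)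

lemma mk_eq_iff: "mk v = mk w \<longleftrightarrow> (\<forall>i<5. [v i = w i] (mod q i))"
proof -
  have "mk v = mk w \<longleftrightarrow> (\<lambda>i\<in>{..<5}. v i mod q i) = (\<lambda>i\<in>{..<5}. w i mod q i)"
    unfolding mk_def by (intro inj_on_eq_iff[OF bij_betw_imp_inj_on[OF bij_enc]] mod_in_reduced)
  also have "\<dots> \<longleftrightarrow> (\<forall>i<5. v i mod q i = w i mod q i)"
    by (auto simp: fun_eq_iff restrict_def)
  finally show ?thesis by (simp add: cong_def)
qed

lemma mk_eqI: "(\<And>i. i < 5 \<Longrightarrow> [v i = w i] (mod q i)) \<Longrightarrow> mk v = mk w"
  by (simp add: mk_eq_iff)

lemma mk_in_carrier [simp]: "mk v \<in> carrier G"
  using bij_enc mod_in_reduced by (auto simp: G_def mk_def bij_betw_def)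

lemma coords_mk: "i < 5 \<Longrightarrow> [coords (mk v) i = v i] (mod q i)"
proof -
  assume "i < 5"
  have "coords (mk v) = (\<lambda>i\<in>{..<5}. v i mod q i)"
    unfolding coords_def mk_def using bij_enc mod_in_reduced by (auto simp: bij_betw_def)
  then show ?thesis using \<open>i < 5\<close> by (simp add: cong_def)
qed

lemma coords_mk_p: "i < 5 \<Longrightarrow> [coords (mk v) i = v i] (mod int p)"
  using coords_mk cong_q_imp_cong_p by blast

lemma mk_coords [simp]: "g \<in> carrier G \<Longrightarrow> mk (coords g) = g"
proof -
  assume g: "g \<in> carrier G"
  then have coords: "coords g \<in> reduced" "enc (coords g) = g"
    using bij_enc by (auto simp: G_def coords_def bij_betw_def inv_into_into f_inv_into_f)
  then have "(\<lambda>i\<in>{..<5}. coords g i mod q i) = coords g"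
    by (intro ext) (auto simp: reduced_def PiE_iff restrict_def extensional_def)
  then show ?thesis using coords by (simp add: mk_def)
qed

lemma mk_cases: "g \<in> carrier G \<Longrightarrow> (\<And>v. g = mk v \<Longrightarrow> thesis) \<Longrightarrow> thesis"
  using mk_coords by metis

lemma vec_mult_cong:
  assumes "\<And>i. i < 5 \<Longrightarrow> [v i = v' i] (mod q i)" "\<And>i. i < 5 \<Longrightarrow> [w i = w' i] (mod q i)" "i < 5"
  shows "[vec_mult v w i = vec_mult v' w' i] (mod q i)"
  unfolding vec_mult_def using assms
  by (intro cong_add cong_q_p_mult bform_cong) (auto intro: cong_q_imp_cong_p)

lemma mk_mult: "mk v \<otimes>\<^bsub>G\<^esub> mk w = mk (vec_mult v w)"
proof -
  have "mk v \<otimes>\<^bsub>G\<^esub> mk w = mk (vec_mult (coords (mk v)) (coords (mk w)))" by (simp add: G_def)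
  also have "\<dots> = mk (vec_mult v w)" by (intro mk_eqI vec_mult_cong coords_mk)
  finally show ?thesis .
qed

lemma one_G: "\<one>\<^bsub>G\<^esub> = mk (\<lambda>i. 0)" by (simp add: G_def)

lemma cong_q_p_squared: "[x + int p * (int p * y) = x] (mod q i)"
  using cong_q_p_mult[of "int p * y" 0 i] by (metis cong_add_lcancel_0 cong_mult_self_left mult_zero_right)

text \<open>Every \<open>q i\<close> divides p^2. Equations in the group thus become integer
  identities, with the multiple of p^2 named by the witness \<open>z\<close>.\<close>

lemma mk_eq_squaredI:
  assumes "\<And>i. v i = w i + int p * (int p * z i)"
  shows "mk v = mk w"
  using assms cong_q_p_squared by (intro mk_eqI) simp

sublocale G: group G
proof (rule groupI)
  fix x y z assume "x \<in> carrier G" "y \<in> carrier G" "z \<in> carrier G"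
  then obtain u v w where eq: "x = mk u" "y = mk v" "z = mk w" by (metis mk_coords)
  have "mk (vec_mult (vec_mult u v) w) = mk (vec_mult u (vec_mult v w))"
  proof (rule mk_eq_squaredI)
    fix i
    \<comment> \<open>By bilinearity the two sides differ only in nested values of
      \<open>bform\<close>, which carry the factor p^2.\<close>
    show "vec_mult (vec_mult u v) w i = vec_mult u (vec_mult v w) i + int p * (int p *
      (bform i (\<lambda>j. bform j u v) w - bform i u (\<lambda>j. bform j v w)))"
      by (simp add: vec_mult_def bform_linear algebra_simps)
  qed
  then show "x \<otimes>\<^bsub>G\<^esub> y \<otimes>\<^bsub>G\<^esub> z = x \<otimes>\<^bsub>G\<^esub> (y \<otimes>\<^bsub>G\<^esub> z)" by (simp add: eq mk_mult)
next
  fix x y assume "x \<in> carrier G" "y \<in> carrier G"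
  then obtain u v where eq: "x = mk u" "y = mk v" by (metis mk_coords)
  show "x \<otimes>\<^bsub>G\<^esub> y \<in> carrier G" by (simp add: eq mk_mult)
next
  show "\<one>\<^bsub>G\<^esub> \<in> carrier G" by (simp add: one_G)
next
  fix x assume "x \<in> carrier G"
  then obtain v where eq: "x = mk v" by (metis mk_coords)
  show "\<one>\<^bsub>G\<^esub> \<otimes>\<^bsub>G\<^esub> x = x" by (simp add: eq one_G mk_mult vec_mult_def bform_linear)
  \<comment> \<open>Negation alone would leave the correction -p b(v,v); the added summand cancels
    it up to a multiple of p^2.\<close>
  have "mk (vec_mult (\<lambda>i. - v i + int p * bform i v v) v) = mk (\<lambda>i. 0)"
    by (rule mk_eq_squaredI[where z = "\<lambda>i. bform i (\<lambda>j. bform j v v) v"])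
      (simp add: vec_mult_def bform_linear algebra_simps)
  then show "\<exists>y\<in>carrier G. y \<otimes>\<^bsub>G\<^esub> x = \<one>\<^bsub>G\<^esub>"
    using eq one_G mk_mult mk_in_carrier by metis
qed

lemma order_G: "order G = p ^ 9" by (simp add: order_def G_def)

lemma coords_mult_p:
  assumes "g \<in> carrier G" "h \<in> carrier G" "i < 5"
  shows "[coords (g \<otimes>\<^bsub>G\<^esub> h) i = coords g i + coords h i] (mod int p)"
proof -
  have "g \<otimes>\<^bsub>G\<^esub> h = mk (vec_mult (coords g) (coords h))" by (simp add: G_def)
  then have "[coords (g \<otimes>\<^bsub>G\<^esub> h) i = vec_mult (coords g) (coords h) i] (mod int p)" using coords_mk_p assms(3) by simp
  also have "[vec_mult (coords g) (coords h) i = coords g i + coords h i] (mod int p)"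
    by (simp add: vec_mult_def cong_iff_dvd_diff)
  finally show ?thesis .
qed

section \<open>Powers and commutators\<close>

text \<open>Passing from n to n + 1 adds n times the correction b(v,v), whence the binomial
  coefficient.\<close>

lemma mk_pow: "mk v [^]\<^bsub>G\<^esub> n = mk (\<lambda>i. int n * v i + int p * (int (n choose 2) * bform i v v))"
proof (induction n)
  case 0 then show ?case by (simp add: one_G numeral_2_eq_2)
next
  case (Suc n)
  let ?u = "\<lambda>i. int n * v i + int p * (int (n choose 2) * bform i v v)"
  have "mk v [^]\<^bsub>G\<^esub> Suc n = mk (vec_mult ?u v)" by (simp add: Suc mk_mult)
  also have "\<dots> = mk (\<lambda>i. int (Suc n) * v i + int p * (int (Suc n choose 2) * bform i v v))"
    by (rule mk_eq_squaredI[where z = "\<lambda>i. int (n choose 2) * bform i (\<lambda>j. bform j v v) v"])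
      (simp add: vec_mult_def bform_linear algebra_simps numeral_2_eq_2)
  finally show ?case .
qed

text \<open>For odd p the number p choose 2 is divisible by p, so the correction is a multiple of
  p^2.\<close>

lemma mk_pow_p: "mk v [^]\<^bsub>G\<^esub> p = mk (\<lambda>i. int p * v i)"
proof -
  have "p \<noteq> 2" using odd by auto
  then have "2 < p" using prime_ge_2_nat[OF prime] by simp
  then have "p dvd p choose 2" using prime by (intro dvd_choose_prime) auto
  then obtain k where k: "p choose 2 = p * k" by blast
  show ?thesis unfolding mk_pow
    by (rule mk_eq_squaredI[where z = "\<lambda>i. int k * bform i v v"]) (simp add: k algebra_simps)
qed

text \<open>Written without inverses, so that a homomorphism can be applied and the result
  translated back into congruences. Coordinate 4 drops out because the corrections are multiples of
  p, its modulus.\<close>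

lemma commutator_relation_iff:
  "mk u \<otimes>\<^bsub>G\<^esub> mk v = mk v \<otimes>\<^bsub>G\<^esub> mk u \<otimes>\<^bsub>G\<^esub> mk w [^]\<^bsub>G\<^esub> p \<longleftrightarrow> (\<forall>i<4. [comm_form i u v = w i] (mod int p))"
proof -
  have less_5: "i < 5 \<longleftrightarrow> i < 4 \<or> i = 4" for i :: nat by arith
  have "mk v \<otimes>\<^bsub>G\<^esub> mk u \<otimes>\<^bsub>G\<^esub> mk w [^]\<^bsub>G\<^esub> p = mk (vec_mult (vec_mult v u) (\<lambda>i. int p * w i))"
    by (simp add: mk_mult mk_pow_p)
  also have "\<dots> = mk (\<lambda>i. v i + u i + int p * (bform i v u + w i))"
    by (rule mk_eq_squaredI[where z = "\<lambda>i. bform i (vec_mult v u) w"])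
      (simp add: vec_mult_def bform_linear algebra_simps)
  finally have "mk u \<otimes>\<^bsub>G\<^esub> mk v = mk v \<otimes>\<^bsub>G\<^esub> mk u \<otimes>\<^bsub>G\<^esub> mk w [^]\<^bsub>G\<^esub> p \<longleftrightarrow>
    (\<forall>i<5. [vec_mult u v i = v i + u i + int p * (bform i v u + w i)] (mod q i))"
    by (simp add: mk_mult mk_eq_iff)
  also have "\<dots> \<longleftrightarrow> (\<forall>i<5. [int p * comm_form i u v = int p * w i] (mod q i))"
    by (simp add: vec_mult_def cong_iff_dvd_diff comm_form_def algebra_simps)
  also have "\<dots> \<longleftrightarrow> (\<forall>i<4. [int p * comm_form i u v = int p * w i] (mod q i))"
    by (auto simp: less_5 q_def[of 4] cong_iff_dvd_diff simp flip: right_diff_distrib)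
  finally show ?thesis by (simp add: cong_q_p_mult_iff)
qed

section \<open>The subgroup \<Phi>, the center, the derived subgroup and the Frattini
  subgroup\<close>

definition \<Phi> :: "nat set" where
  "\<Phi> = {g \<in> carrier G. \<forall>i<5. int p dvd coords g i}"

lemma mk_in_\<Phi>_iff: "mk v \<in> \<Phi> \<longleftrightarrow> (\<forall>i<5. int p dvd v i)"
  by (simp add: \<Phi>_def cong_dvd_iff[OF coords_mk_p])

lemma \<Phi>_eq: "\<Phi> = range (\<lambda>v. mk (\<lambda>i. int p * v i))"
proof
  show "\<Phi> \<subseteq> range (\<lambda>v. mk (\<lambda>i. int p * v i))"
  proof
    fix g assume g: "g \<in> \<Phi>"
    then have "mk (coords g) = mk (\<lambda>i. int p * (coords g i div int p))"
      by (intro mk_eqI) (simp add: \<Phi>_def)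
    then have "g = mk (\<lambda>i. int p * (coords g i div int p))" using g by (simp add: \<Phi>_def)
    then show "g \<in> range (\<lambda>v. mk (\<lambda>i. int p * v i))"
      by (rule range_eqI[where x = "\<lambda>i. coords g i div int p"])
  qed
qed (auto simp: mk_in_\<Phi>_iff)

lemma \<Phi>_subset_center: "\<Phi> \<subseteq> center G"
proof -
  have "mk (\<lambda>i. int p * v i) \<otimes>\<^bsub>G\<^esub> mk w = mk w \<otimes>\<^bsub>G\<^esub> mk (\<lambda>i. int p * v i)" for v w
    unfolding mk_mult by (rule mk_eq_squaredI[where z = "\<lambda>i. bform i v w - bform i w v"])
      (simp add: vec_mult_def bform_linear algebra_simps)
  then show ?thesis unfolding \<Phi>_eq center_def by (auto elim!: mk_cases)
qed

text \<open>No product in \<open>bform\<close> reads coordinate 3. This element shows that the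
  center is larger than \<open>\<Phi>\<close>.\<close>

lemma unit_vec_3_in_center: "mk (unit_vec 3) \<in> center G"
proof -
  have "mk (unit_vec 3) \<otimes>\<^bsub>G\<^esub> mk w = mk w \<otimes>\<^bsub>G\<^esub> mk (unit_vec 3)" for w
  proof -
    have "bform i (unit_vec 3) w = 0" "bform i w (unit_vec 3) = 0" for i
      by (simp_all add: bform_def unit_vec_def)
    then show ?thesis by (simp add: mk_mult vec_mult_def add.commute)
  qed
  then show ?thesis unfolding center_def by (auto elim!: mk_cases)
qed

lemma unit_vec_3_notin_\<Phi>: "mk (unit_vec 3) \<notin> \<Phi>"
proof -
  have "\<not> int p dvd unit_vec 3 3" using prime_int by (auto simp: unit_vec_def)
  moreover have "(3::nat) < 5" by simp
  ultimately show ?thesis unfolding mk_in_\<Phi>_iff by blast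
qed

lemma subgroup_\<Phi>: "subgroup \<Phi> G"
proof (rule G.subgroupI)
  have mult: "mk (\<lambda>i. int p * v i) \<otimes>\<^bsub>G\<^esub> mk (\<lambda>i. int p * w i) = mk (\<lambda>i. int p * (v i + w i))" for v w
    unfolding mk_mult by (rule mk_eq_squaredI[where z = "\<lambda>i. int p * bform i v w"])
      (simp add: vec_mult_def bform_linear algebra_simps)
  have inv: "inv\<^bsub>G\<^esub> mk (\<lambda>i. int p * v i) = mk (\<lambda>i. int p * (- v i))" for v
    by (rule G.inv_equality) (simp_all only: mult mk_in_carrier, simp add: one_G)
  show "\<Phi> \<noteq> {}" unfolding \<Phi>_eq by blast
  show "inv\<^bsub>G\<^esub> g \<in> \<Phi>" if "g \<in> \<Phi>" for g using that inv unfolding \<Phi>_eq by fastforce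
  show "g \<otimes>\<^bsub>G\<^esub> h \<in> \<Phi>" if "g \<in> \<Phi>" "h \<in> \<Phi>" for g h using that mult unfolding \<Phi>_eq by fastforce
qed (auto simp: \<Phi>_def)

lemma mk_commutator:
  "mk u \<otimes>\<^bsub>G\<^esub> mk v \<otimes>\<^bsub>G\<^esub> inv\<^bsub>G\<^esub> mk u \<otimes>\<^bsub>G\<^esub> inv\<^bsub>G\<^esub> mk v = mk (\<lambda>i. int p * comm_form i u v)"
proof -
  have "mk (\<lambda>i. int p * comm_form i u v) \<in> \<Phi>" by (simp add: mk_in_\<Phi>_iff)
  then have cen: "mk (\<lambda>i. int p * comm_form i u v) \<in> center G" using \<Phi>_subset_center by blast
  have "mk u \<otimes>\<^bsub>G\<^esub> mk v = mk v \<otimes>\<^bsub>G\<^esub> mk u \<otimes>\<^bsub>G\<^esub> mk (\<lambda>i. int p * comm_form i u v)"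
    using commutator_relation_iff[of u v "\<lambda>i. comm_form i u v"] mk_pow_p[of "\<lambda>i. comm_form i u v"] by simp
  also have "\<dots> = mk (\<lambda>i. int p * comm_form i u v) \<otimes>\<^bsub>G\<^esub> (mk v \<otimes>\<^bsub>G\<^esub> mk u)"
    using cen by (simp add: center_def)
  finally show ?thesis
    by (simp add: G.m_assoc G.inv_mult_group[symmetric])
qed

lemma derived_G: "derived G (carrier G) = \<Phi>"
proof
  show "derived G (carrier G) \<subseteq> \<Phi>"
    unfolding derived_def
    by (rule G.generate_subgroup_incl[OF _ subgroup_\<Phi>])
      (auto elim!: mk_cases simp: mk_commutator mk_in_\<Phi>_iff)
next
  let ?D = "derived G (carrier G)"
  have comm: "mk (\<lambda>i. int p * comm_form i u v) \<in> ?D" for u v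
    unfolding derived_def mk_commutator[symmetric] using mk_in_carrier
    by (intro generate.incl) blast
  have sub: "subgroup ?D G" by (simp add: G.derived_is_subgroup)
  have "mk (\<lambda>i. int p * v i) \<in> ?D" for v
  proof -
    \<comment> \<open>Two commutators suffice by bilinearity: commuting with x4 takes x1, x2, x0 to
      the p-th powers of x0, x1, x3, and [x0,x2] = x2^p supplies coordinate 2.\<close>
    let ?u = "\<lambda>i. if i = 0 then v 3 else if i = 1 then v 0 else if i = 2 then v 1 else 0"
    let ?w = "\<lambda>i. v 2 * unit_vec 0 i"
    let ?a = "\<lambda>i. comm_form i ?u (unit_vec 4)" and ?c = "\<lambda>i. comm_form i ?w (unit_vec 2)"
    have "mk (\<lambda>i. int p * v i) = mk (\<lambda>i. int p * ?a i) \<otimes>\<^bsub>G\<^esub> mk (\<lambda>i. int p * ?c i)"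
      unfolding mk_mult
    proof (rule mk_eqI)
      fix i :: nat assume "i < 5"
      then consider "i < 4" | "i = 4" by linarith
      then show "[int p * v i = vec_mult (\<lambda>i. int p * ?a i) (\<lambda>i. int p * ?c i) i] (mod q i)"
      proof cases
        case 1
        then have "i = 0 \<or> i = 1 \<or> i = 2 \<or> i = 3" by linarith
        then have "v i = ?a i + ?c i" by (auto simp: comm_form_def bform_def unit_vec_def)
        then have "vec_mult (\<lambda>i. int p * ?a i) (\<lambda>i. int p * ?c i) i =
            int p * v i + int p * (int p * (int p * bform i ?a ?c))"
          unfolding vec_mult_def bform_linear by (simp only: distrib_left mult.assoc)
        then show ?thesis using cong_q_p_squared by (simp add: cong_sym_eq)
      next
        case 2
        then show ?thesis by (simp add: vec_mult_def q_def cong_iff_dvd_diff)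
      qed
    qed
    then show ?thesis using comm sub by (simp add: subgroup.m_closed)
  qed
  then show "\<Phi> \<subseteq> ?D" unfolding \<Phi>_eq by blast
qed

text \<open>Each of the five coordinates modulo p is a homomorphism onto the integers modulo p, so
  its kernel is maximal, and these kernels meet in \<open>\<Phi>\<close>. Conversely
  \<open>\<Phi>\<close> is both central and derived.\<close>

lemma frattini_G: "frattini G = \<Phi>"
proof
  show "\<Phi> \<subseteq> frattini G"
    using G.derived_Int_center_subset_frattini \<Phi>_subset_center by (auto simp: derived_G)
  show "frattini G \<subseteq> \<Phi>"
  proof
    fix g assume g: "g \<in> frattini G"
    have "int p dvd coords g i" if i: "i < 5" for i
    proof -
      have "[coords (mk (unit_vec i)) i = 1] (mod int p)" using coords_mk_p[OF i, of "unit_vec i"] by (simp add: unit_vec_def)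
      then have "\<not> int p dvd coords (mk (unit_vec i)) i"
        using cong_dvd_iff prime_int not_prime_unit by blast
      then have "maximal_subgroup {g \<in> carrier G. int p dvd coords g i} G"
        using i by (intro G.maximal_subgroup_hom_mod_prime[OF prime_int, of _ "mk (unit_vec i)"])
          (auto intro: coords_mult_p)
      then show ?thesis using g by (auto simp: frattini_def)
    qed
    then show "g \<in> \<Phi>" using g by (auto simp: \<Phi>_def frattini_def)
  qed
qed

lemma elementary_abelian_\<Phi>: "elementary_abelian p (G\<lparr>carrier := \<Phi>\<rparr>)"
  unfolding elementary_abelian_def
proof
  interpret S: group "G\<lparr>carrier := \<Phi>\<rparr>"
    using subgroup_\<Phi> by (rule subgroup.subgroup_is_group) (rule G.is_group)
  show "comm_group (G\<lparr>carrier := \<Phi>\<rparr>)"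
    using \<Phi>_subset_center by (intro S.group_comm_groupI) (auto simp: center_def \<Phi>_def)
  show "\<forall>x\<in>carrier (G\<lparr>carrier := \<Phi>\<rparr>). x [^]\<^bsub>G\<lparr>carrier := \<Phi>\<rparr>\<^esub> p = \<one>\<^bsub>G\<lparr>carrier := \<Phi>\<rparr>\<^esub>"
  proof
    fix g assume "g \<in> carrier (G\<lparr>carrier := \<Phi>\<rparr>)"
    then obtain v where g: "g = mk (\<lambda>i. int p * v i)" unfolding \<Phi>_eq by auto
    have "g [^]\<^bsub>G\<lparr>carrier := \<Phi>\<rparr>\<^esub> p = g [^]\<^bsub>G\<^esub> p" by (simp add: nat_pow_def)
    also have "\<dots> = mk (\<lambda>i. 0)"
      unfolding g mk_pow_p by (rule mk_eq_squaredI[where z = v]) simp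
    finally show "g [^]\<^bsub>G\<lparr>carrier := \<Phi>\<rparr>\<^esub> p = \<one>\<^bsub>G\<lparr>carrier := \<Phi>\<rparr>\<^esub>" by (simp add: one_G)
  qed
qed

section \<open>The automorphisms x_k -> x_k c_k\<close>

text \<open>Row \<open>k\<close> of \<open>C\<close> holds the exponents of c_k divided by p. The
  restriction to the carrier is there because \<open>auto\<close> consists of extensional
  functions.\<close>

definition aut :: "(nat \<times> nat \<Rightarrow> int) \<Rightarrow> nat \<Rightarrow> nat" where
  "aut C = (\<lambda>g\<in>carrier G. mk (\<lambda>i. coords g i + int p * lin C (coords g) i))"

lemma aut_mk: "aut C (mk v) = mk (\<lambda>i. v i + int p * lin C v i)"
  unfolding aut_def
  by (simp, intro mk_eqI cong_add cong_q_p_mult lin_cong coords_mk coords_mk_p cong_refl)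

lemma aut_eqI:
  assumes "\<And>v. aut C (mk v) = f (mk v)" "f \<in> extensional (carrier G)"
  shows "aut C = f"
proof
  fix g show "aut C g = f g"
    using assms(1)[of "coords g"] assms(2)
    by (cases "g \<in> carrier G") (simp_all add: aut_def extensional_def)
qed

text \<open>Modulo p^2 the product of 1 + pC and 1 + pD is 1 + p(C + D), so composition becomes
  addition.\<close>

lemma aut_aut: "aut C (aut D (mk v)) = aut (\<lambda>x. C x + D x) (mk v)"
  unfolding aut_mk by (rule mk_eq_squaredI[where z = "\<lambda>i. lin C (lin D v) i"])
    (simp add: lin_add lin_scale lin_add_matrix algebra_simps)

lemma aut_zero: "aut (\<lambda>x. 0) (mk v) = mk v"
  by (simp add: aut_mk lin_zero_matrix)

lemma aut_hom: "aut C \<in> hom G G"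
proof (rule homI)
  fix g h assume gh: "g \<in> carrier G" "h \<in> carrier G"
  then show "aut C g \<in> carrier G" by (simp add: aut_def)
  obtain v w where eq: "g = mk v" "h = mk w" using gh by (metis mk_coords)
  \<comment> \<open>Applying \<open>lin C\<close> to the correction, or shifting the arguments of
    \<open>bform\<close> by multiples of p, only creates multiples of p^2; the witness collects
    them.\<close>
  show "aut C (g \<otimes>\<^bsub>G\<^esub> h) = aut C g \<otimes>\<^bsub>G\<^esub> aut C h"
    unfolding eq mk_mult aut_mk
    by (rule mk_eq_squaredI[where z = "\<lambda>i. lin C (\<lambda>j. bform j v w) i - bform i (lin C v) w - bform i v (lin C w)
      - int p * bform i (lin C v) (lin C w)"])
      (simp add: vec_mult_def bform_linear lin_add lin_scale algebra_simps)
qed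

lemma aut_in_auto: "aut C \<in> auto G"
proof -
  have inverse: "aut C (aut D g) = g" if "g \<in> carrier G" "\<And>x. C x + D x = 0" for C D g
    using that aut_aut[of C D "coords g"] aut_zero[of "coords g"] by simp
  have "bij_betw (aut C) (carrier G) (carrier G)"
    by (rule bij_betw_byWitness[where f' = "aut (\<lambda>x. - C x)"])
      (use inverse in \<open>auto simp: aut_def\<close>)
  then show ?thesis using aut_hom by (simp add: auto_def Bij_def aut_def)
qed

text \<open>The bound 4 on \<open>i\<close> reflects x4^p = 1: column 4 contributes only powers of
  x4^p.\<close>

lemma aut_eq_iff: "aut C = aut D \<longleftrightarrow> (\<forall>k<5. \<forall>i<4. [C (k, i) = D (k, i)] (mod int p))"
proof
  assume eq: "aut C = aut D"
  show "\<forall>k<5. \<forall>i<4. [C (k, i) = D (k, i)] (mod int p)"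
  proof (intro allI impI)
    fix k i :: nat assume k: "k < 5" and i: "i < 4"
    have "aut C (mk (unit_vec k)) = aut D (mk (unit_vec k))" using eq by simp
    then have "[int p * C (k, i) = int p * D (k, i)] (mod q i)"
      using k i by (simp add: aut_mk mk_eq_iff lin_unit_vec cong_add_lcancel)
    then show "[C (k, i) = D (k, i)] (mod int p)" using i by (simp add: cong_q_p_mult_iff)
  qed
next
  assume cong: "\<forall>k<5. \<forall>i<4. [C (k, i) = D (k, i)] (mod int p)"
  show "aut C = aut D"
  proof (rule aut_eqI)
    fix v show "aut C (mk v) = aut D (mk v)"
      unfolding aut_mk
    proof (rule mk_eqI)
      fix i :: nat assume "i < 5"
      then consider "i < 4" | "i = 4" by linarith
      then show "[v i + int p * lin C v i = v i + int p * lin D v i] (mod q i)"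
      proof cases
        case 1
        then show ?thesis using cong by (intro cong_add cong_refl cong_q_p_mult lin_cong) auto
      next
        case 2
        then show ?thesis by (simp add: q_def cong_iff_dvd_diff)
      qed
    qed
  qed (simp add: aut_def)
qed

section \<open>Every automorphism has this form\<close>

text \<open>The x_k generate the group: \<open>g\<close> is assembled from its normal form, one
  generator at a time.\<close>

lemma hom_eq_on_unit_vecs:
  assumes f: "f \<in> hom G G" and h: "h \<in> hom G G"
    and eq: "\<And>k. k < 5 \<Longrightarrow> f (mk (unit_vec k)) = h (mk (unit_vec k))"
    and g: "g \<in> carrier G"
  shows "f g = h g"
proof -
  interpret f: group_hom G G f using f by unfold_locales
  interpret h: group_hom G G h using h by unfold_locales
  \<comment> \<open>Residues are nonnegative and so can serve as natural exponents.\<close>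
  define n where "n i = nat (coords g i mod q i)" for i
  \<comment> \<open>The cocycle vanishes on pairs of unit vectors with weakly descending indices, so the product of
    the powers of the generators, taken in descending order, needs no correction terms.\<close>
  define t where "t j = (\<lambda>i. if 5 \<le> i + j then int (n i) else 0)" for j
  have n: "int (n i) = coords g i mod q i" for i using q_pos[of i] by (simp add: n_def)
  have "f (mk (t j)) = h (mk (t j))" if "j \<le> 5" for j
    using that
  proof (induction j)
    case 0
    \<comment> \<open>\<open>t 0\<close> vanishes below index 5, and \<open>mk\<close> ignores all
      further coordinates.\<close>
    have "mk (t 0) = \<one>\<^bsub>G\<^esub>" unfolding one_G by (rule mk_eqI) (simp add: t_def)
    then show ?case by simp
  next
    case (Suc j)
    then have j: "j = 0 \<or> j = 1 \<or> j = 2 \<or> j = 3 \<or> j = 4" by linarith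
    \<comment> \<open>Step \<open>j\<close> appends a power of x_(4-j), so \<open>t 5\<close>
      contains all five coordinates.\<close>
    let ?e = "mk (unit_vec (4 - j))"
    have pow: "?e [^]\<^bsub>G\<^esub> n (4 - j) = mk (\<lambda>i. int (n (4 - j)) * unit_vec (4 - j) i)"
      unfolding mk_pow using j by (intro mk_eqI) (auto simp: bform_def unit_vec_def)
    have "mk (t (Suc j)) = mk (t j) \<otimes>\<^bsub>G\<^esub> ?e [^]\<^bsub>G\<^esub> n (4 - j)"
      unfolding pow mk_mult
    proof (rule mk_eqI)
      fix i :: nat assume "i < 5"
      have "bform i (t j) (\<lambda>i. int (n (4 - j)) * unit_vec (4 - j) i) = 0"
        using j by (auto simp: bform_def t_def unit_vec_def)
      moreover have "t (Suc j) i = t j i + int (n (4 - j)) * unit_vec (4 - j) i"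
        using \<open>i < 5\<close> Suc.prems by (auto simp: t_def unit_vec_def)
      ultimately show "[t (Suc j) i = vec_mult (t j) (\<lambda>i. int (n (4 - j)) * unit_vec (4 - j) i) i] (mod q i)"
        by (simp add: vec_mult_def)
    qed
    moreover have "f ?e = h ?e" by (rule eq) simp
    ultimately show ?case using Suc by (simp add: f.hom_nat_pow h.hom_nat_pow)
  qed
  then have "f (mk (t 5)) = h (mk (t 5))" by simp
  moreover have "mk (t 5) = mk (coords g)" by (rule mk_eqI) (simp add: t_def n cong_def)
  ultimately show ?thesis using g by simp
qed

text \<open>An automorphism preserves the commutator relations and the triviality of p-th powers.
  Hence the exponents of the images of the generators satisfy the hypotheses of
  \<open>rigid_relations_mod_prime\<close>.\<close>

lemma auto_rigid:
  assumes f: "f \<in> auto G" and k: "k < 5" and i: "i < 5"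
  shows "[coords (f (mk (unit_vec k))) i = unit_vec k i] (mod int p)"
proof -
  have hom: "f \<in> hom G G" and bij: "bij_betw f (carrier G) (carrier G)"
    using f by (auto simp: auto_def Bij_def)
  interpret f: group_hom G G f using hom by unfold_locales
  define \<phi> where "\<phi> v = coords (f (mk v))" for v
  have mk_\<phi>: "f (mk v) = mk (\<phi> v)" for v by (simp add: \<phi>_def)
  have rel: "\<forall>i<4. [comm_form i (\<phi> u) (\<phi> v) = \<phi> w i] (mod int p)"
    if "\<forall>i<4. [comm_form i u v = w i] (mod int p)" for u v w
  proof -
    have "f (mk u \<otimes>\<^bsub>G\<^esub> mk v) = f (mk v \<otimes>\<^bsub>G\<^esub> mk u \<otimes>\<^bsub>G\<^esub> mk w [^]\<^bsub>G\<^esub> p)"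
      using that commutator_relation_iff by metis
    then show ?thesis
      by (simp add: f.hom_nat_pow mk_\<phi> commutator_relation_iff)
  qed
  \<comment> \<open>A trivial commutator is the relation with \<open>w\<close> zero; transporting it
    requires the image of the zero vector.\<close>
  have phi_zero: "[\<phi> (\<lambda>i. 0) i = 0] (mod int p)" if "i < 5" for i
    using coords_mk_p[OF that, of "\<lambda>i. 0"] f.hom_one by (simp add: \<phi>_def flip: one_G)
  have rel_0: "\<forall>i<4. [comm_form i (\<phi> u) (\<phi> v) = 0] (mod int p)"
    if "\<forall>i<4. [comm_form i u v = 0] (mod int p)" for u v
  proof (intro allI impI)
    fix i :: nat assume "i < 4"
    then show "[comm_form i (\<phi> u) (\<phi> v) = 0] (mod int p)"
      using rel[OF that] phi_zero[of i] cong_trans by simp blast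
  qed
  \<comment> \<open>With both commutator arguments zero, the relation says just that the p-th power
    is trivial.\<close>
  have pow_p: "(\<forall>i<4. int p dvd v i) \<longleftrightarrow> mk v [^]\<^bsub>G\<^esub> p = \<one>\<^bsub>G\<^esub>" for v
    using commutator_relation_iff[of "\<lambda>i. 0" "\<lambda>i. 0" v]
    by (simp add: comm_form_def bform_zero cong_sym_eq[of 0] cong_0_iff flip: one_G) metis
  have pow_p_image: "(\<forall>i<4. int p dvd \<phi> v i) \<longleftrightarrow> (\<forall>i<4. int p dvd v i)" for v
  proof -
    have "f (mk v [^]\<^bsub>G\<^esub> p) = f \<one>\<^bsub>G\<^esub> \<longleftrightarrow> mk v [^]\<^bsub>G\<^esub> p = \<one>\<^bsub>G\<^esub>"
      using bij by (intro inj_on_eq_iff[OF bij_betw_imp_inj_on]) auto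
    then show ?thesis unfolding pow_p by (simp add: f.hom_nat_pow mk_\<phi>)
  qed
  define a where "a k = \<phi> (unit_vec k)" for k
  have all_4: "(\<forall>i<4. P i) \<longleftrightarrow> P 0 \<and> P 1 \<and> P 2 \<and> P 3" for P :: "nat \<Rightarrow> bool"
    by (auto simp: numeral_eq_Suc less_Suc_eq)
  note unit_simps = all_4 comm_form_def bform_def unit_vec_def
  note rel_simps = all_4 comm_form_def bform_def cong_iff_dvd_diff
  \<comment> \<open>Each relation yields one congruence per coordinate below 4; the digits in the
    fact names are the two generators commuted.\<close>
  have r24: "int p dvd a 2 1 * a 4 4 - a 4 1 * a 2 4 - a 1 0"
      "int p dvd a 2 2 * a 4 4 - a 4 2 * a 2 4 - a 1 1"
      "int p dvd (a 2 0 + a 2 1) * a 4 2 - (a 4 0 + a 4 1) * a 2 2 - a 1 2"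
      "int p dvd a 2 0 * a 4 4 - a 4 0 * a 2 4 - a 1 3"
    using rel[of "unit_vec 2" "unit_vec 4" "unit_vec 1"] unfolding a_def
    by (simp_all add: unit_simps) (simp_all add: rel_simps)
  have r14: "int p dvd a 1 1 * a 4 4 - a 4 1 * a 1 4 - a 0 0"
      "int p dvd a 1 2 * a 4 4 - a 4 2 * a 1 4 - a 0 1"
      "int p dvd (a 1 0 + a 1 1) * a 4 2 - (a 4 0 + a 4 1) * a 1 2 - a 0 2"
      "int p dvd a 1 0 * a 4 4 - a 4 0 * a 1 4 - a 0 3"
    using rel[of "unit_vec 1" "unit_vec 4" "unit_vec 0"] unfolding a_def
    by (simp_all add: unit_simps) (simp_all add: rel_simps)
  have r04: "int p dvd a 0 1 * a 4 4 - a 4 1 * a 0 4 - a 3 0"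
      "int p dvd a 0 2 * a 4 4 - a 4 2 * a 0 4 - a 3 1"
      "int p dvd (a 0 0 + a 0 1) * a 4 2 - (a 4 0 + a 4 1) * a 0 2 - a 3 2"
      "int p dvd a 0 0 * a 4 4 - a 4 0 * a 0 4 - a 3 3"
    using rel[of "unit_vec 0" "unit_vec 4" "unit_vec 3"] unfolding a_def
    by (simp_all add: unit_simps) (simp_all add: rel_simps)
  have r02: "int p dvd a 0 1 * a 2 4 - a 2 1 * a 0 4 - a 2 0"
      "int p dvd a 0 2 * a 2 4 - a 2 2 * a 0 4 - a 2 1"
      "int p dvd (a 0 0 + a 0 1) * a 2 2 - (a 2 0 + a 2 1) * a 0 2 - a 2 2"
      "int p dvd a 0 0 * a 2 4 - a 2 0 * a 0 4 - a 2 3"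
    using rel[of "unit_vec 0" "unit_vec 2" "unit_vec 2"] unfolding a_def
    by (simp_all add: unit_simps) (simp_all add: rel_simps)
  have r12: "int p dvd a 1 1 * a 2 4 - a 2 1 * a 1 4 - a 2 0"
      "int p dvd (a 1 0 + a 1 1) * a 2 2 - (a 2 0 + a 2 1) * a 1 2 - a 2 2"
    using rel[of "unit_vec 1" "unit_vec 2" "unit_vec 2"] unfolding a_def
    by (simp_all add: unit_simps) (simp_all add: rel_simps)
  have r01: "int p dvd a 0 1 * a 1 4 - a 1 1 * a 0 4"
      "int p dvd a 0 0 * a 1 4 - a 1 0 * a 0 4"
    using rel_0[of "unit_vec 0" "unit_vec 1"] unfolding a_def
    by (simp_all add: unit_simps) (simp_all add: rel_simps)
  have r03: "int p dvd a 0 0 * a 3 4 - a 3 0 * a 0 4"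
    using rel_0[of "unit_vec 0" "unit_vec 3"] unfolding a_def
    by (simp_all add: unit_simps) (simp_all add: rel_simps)
  \<comment> \<open>x4 has trivial p-th power, and therefore so does its image.\<close>
  have z: "int p dvd a 4 0" "int p dvd a 4 1" "int p dvd a 4 2" "int p dvd a 4 3"
  proof -
    have "\<forall>i<4. int p dvd a 4 i"
      unfolding a_def by (rule iffD2[OF pow_p_image]) (simp add: unit_vec_def)
    then show "int p dvd a 4 0" "int p dvd a 4 1" "int p dvd a 4 2" "int p dvd a 4 3" by simp_all
  qed
  \<comment> \<open>x3^p is nontrivial, and injectivity keeps its image nontrivial.\<close>
  have nz: "\<not> (int p dvd a 3 0 \<and> int p dvd a 3 1 \<and> int p dvd a 3 2 \<and> int p dvd a 3 3)"
  proof -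
    have "\<not> (\<forall>i<4. int p dvd unit_vec 3 i)"
      using prime_int by (auto simp: unit_vec_def intro!: exI[of _ 3])
    then have "\<not> (\<forall>i<4. int p dvd a 3 i)" unfolding a_def pow_p_image .
    then show ?thesis unfolding all_4 .
  qed
  note rigid = rigid_relations_mod_prime[OF prime_int z r24 r14 r04 r02 r12 r01 r03 nz]
  have "k = 0 \<or> k = 1 \<or> k = 2 \<or> k = 3 \<or> k = 4" "i = 0 \<or> i = 1 \<or> i = 2 \<or> i = 3 \<or> i = 4"
    using k i by linarith+
  then have "int p dvd a k i - unit_vec k i"
    using rigid z unfolding unit_vec_def by (elim disjE) simp_all
  then show ?thesis by (simp add: a_def \<phi>_def cong_iff_dvd_diff)
qed

lemma auto_G: "auto G = aut ` (({..<5} \<times> {..<4}) \<rightarrow>\<^sub>E {0..<int p})"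
proof
  show "auto G \<subseteq> aut ` (({..<5} \<times> {..<4}) \<rightarrow>\<^sub>E {0..<int p})"
  proof
    fix f assume f: "f \<in> auto G"
    \<comment> \<open>By \<open>auto_rigid\<close> this division is exact for \<open>k\<close> and
      \<open>i\<close> below 5. \<open>D\<close> is the representative with entries in the required
      range.\<close>
    define C where "C = (\<lambda>(k, i). (coords (f (mk (unit_vec k))) i - unit_vec k i) div int p)"
    define D where "D = (\<lambda>x\<in>{..<5} \<times> {..<4}. C x mod int p)"
    have "aut C (mk (unit_vec k)) = f (mk (unit_vec k))" if k: "k < 5" for k
    proof -
      have "aut C (mk (unit_vec k)) = mk (coords (f (mk (unit_vec k))))"
        unfolding aut_mk using auto_rigid[OF f k] k
        by (intro mk_eqI) (simp add: lin_unit_vec C_def cong_iff_dvd_diff)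
      then show ?thesis using f by (auto simp: auto_def hom_def Pi_iff)
    qed
    then have eq: "aut C g = f g" if "g \<in> carrier G" for g
      using hom_eq_on_unit_vecs[OF aut_hom, of f] f that by (simp add: auto_def)
    have "aut C = f" using f by (intro aut_eqI eq) (auto simp: auto_def Bij_def)
    moreover have "aut D = aut C" by (simp add: aut_eq_iff D_def)
    moreover have "D \<in> ({..<5} \<times> {..<4}) \<rightarrow>\<^sub>E {0..<int p}" using p_pos by (auto simp: D_def)
    ultimately show "f \<in> aut ` (({..<5} \<times> {..<4}) \<rightarrow>\<^sub>E {0..<int p})" by (metis imageI)
  qed
qed (use aut_in_auto in blast)

lemma inj_on_aut: "inj_on aut (({..<5} \<times> {..<4}) \<rightarrow>\<^sub>E {0..<int p})"
proof (rule inj_onI)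
  fix C D assume CD: "C \<in> ({..<5} \<times> {..<4}) \<rightarrow>\<^sub>E {0..<int p}" "D \<in> ({..<5} \<times> {..<4}) \<rightarrow>\<^sub>E {0..<int p}"
    and eq: "aut C = aut D"
  show "C = D"
  proof (rule PiE_ext[OF CD])
    fix x :: "nat \<times> nat" assume x: "x \<in> {..<5} \<times> {..<4}"
    then have "C x \<in> {0..<int p}" "D x \<in> {0..<int p}" using CD by blast+
    moreover have "[C x = D x] (mod int p)" using eq x by (auto simp: aut_eq_iff)
    ultimately show "C x = D x" by (simp add: cong_def)
  qed
qed

section \<open>Order and structure of the automorphism group\<close>

text \<open>The matrices have 5 times 4 entries with p values each, and distinct ones give distinct
  automorphisms.\<close>

lemma order_AutoGroup: "order (AutoGroup G) = p ^ 20"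
  by (simp add: order_def AutoGroup_def auto_G card_image[OF inj_on_aut] card_PiE card_cartesian_product)

lemma AutoGroup_mult: "aut C \<otimes>\<^bsub>AutoGroup G\<^esub> aut D = aut (\<lambda>x. C x + D x)"
proof -
  have "aut C \<otimes>\<^bsub>AutoGroup G\<^esub> aut D = compose (carrier G) (aut C) (aut D)"
    using aut_in_auto by (auto simp: AutoGroup_def BijGroup_def auto_def)
  also have "\<dots> = aut (\<lambda>x. C x + D x)"
    by (rule sym, rule aut_eqI) (simp_all add: compose_def aut_aut)
  finally show ?thesis .
qed

lemma AutoGroup_one: "\<one>\<^bsub>AutoGroup G\<^esub> = aut (\<lambda>x. 0)"
  by (rule sym, rule aut_eqI) (simp_all add: AutoGroup_def BijGroup_def aut_zero)

lemma elementary_abelian_AutoGroup: "elementary_abelian p (AutoGroup G)"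
  unfolding elementary_abelian_def
proof (intro conjI ballI)
  interpret A: group "AutoGroup G" by (rule G.AutoGroup)
  have ex: "\<exists>C. f = aut C" if "f \<in> carrier (AutoGroup G)" for f
    using that by (auto simp: AutoGroup_def auto_G)
  show "comm_group (AutoGroup G)"
  proof (rule A.group_comm_groupI)
    fix f h assume "f \<in> carrier (AutoGroup G)" "h \<in> carrier (AutoGroup G)"
    then obtain C D where "f = aut C" "h = aut D" using ex by metis
    then show "f \<otimes>\<^bsub>AutoGroup G\<^esub> h = h \<otimes>\<^bsub>AutoGroup G\<^esub> f" by (simp add: AutoGroup_mult add.commute)
  qed
  fix f assume "f \<in> carrier (AutoGroup G)"
  then obtain C where f: "f = aut C" using ex by blast
  \<comment> \<open>Composition adds matrices, so the p-th power has matrix p C, which is zero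
    modulo p.\<close>
  have pow: "f [^]\<^bsub>AutoGroup G\<^esub> n = aut (\<lambda>x. int n * C x)" for n :: nat
    by (induction n) (simp_all add: f AutoGroup_one AutoGroup_mult algebra_simps)
  show "f [^]\<^bsub>AutoGroup G\<^esub> p = \<one>\<^bsub>AutoGroup G\<^esub>"
    unfolding pow AutoGroup_one by (simp add: aut_eq_iff cong_iff_dvd_diff)
qed

end

theorem theoremB:
  fixes p :: nat
  assumes "prime p" and "odd p"
  shows "\<exists>G :: nat monoid.
           group G \<and> order G = p ^ 9 \<and>
           elementary_abelian p (AutoGroup G) \<and> order (AutoGroup G) = p ^ 20 \<and>
           frattini G \<subset> center G \<and>
           derived G (carrier G) = frattini G \<and>
           elementary_abelian p (G\<lparr>carrier := frattini G\<rparr>)"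
proof -
  interpret odd_prime p using assms by unfold_locales
  have "\<Phi> \<subset> center G"
    using \<Phi>_subset_center unit_vec_3_in_center unit_vec_3_notin_\<Phi> by blast
  then show ?thesis
    using G.is_group order_G elementary_abelian_AutoGroup order_AutoGroup derived_G
      elementary_abelian_\<Phi> by (intro exI[of _ G]) (simp add: frattini_G)
qed

end
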